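(* Let $n\ge 2$ and let $\{1,\dots,n\}=C\,\dot\cup\,D$ be a partition with $|C|=m\ge 1$ and $|D|=n-m\ge 1$. Let $S\in\mathbb{C}^{n\times n}$ be such that $S_{DD}$ is invertible, $\xi\in\mathbb{R}$ with $\xi\neq 0$, $P=\mathrm{diag}(\mathbf 1_{i\in C})$, and let $\widehat K\in\mathbb{C}^{n\times n}$ be Hermitian positive definite; all of these are fixed independently of $b$. For $b>0$ set $\widehat A=S+ib\xi P$ and $\widehat G=\widehat A\,\widehat K\,\widehat A^{\mathsf H}$. Then, as $b\to\infty$, $$\lambda_{\max}(\widehat G)=b^{2}\xi^{2}\,\lambda_{\max}\bigl(\widehat K_{CC}\bigr)\bigl(1+O(b^{-1})\bigr),$$ $$\lambda_{\min}(\widehat G)\longrightarrow\lambda_{\min}\Bigl(S_{DD}\,\bigl(\widehat K/\widehat K_{CC}\bigr)\,S_{DD}^{\mathsf H}\Bigr)>0,$$ and any unit eigenvector $v^{b}$ of $\widehat G$ associated with $\lambda_{\min}(\widehat G)$ satisfies $\|v_C^{b}\|_2=O(b^{-1})$.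
   Context: $M^{\mathsf H}$ denotes the conjugate transpose; $\lambda_{\min},\lambda_{\max}$ denote the smallest and largest eigenvalues of a Hermitian matrix. For $M\in\mathbb{C}^{n\times n}$ and the partition $\{1,\dots,n\}=C\,\dot\cup\,D$, the blocks of $M$ are denoted $M_{CC}$, $M_{CD}$, $M_{DC}$, $M_{DD}$, and for $v\in\mathbb{C}^n$, $v_C$ denotes the subvector of coordinates indexed by $C$. When $M_{CC}$ is invertible, the Schur complement is $M/M_{CC}:=M_{DD}-M_{DC}M_{CC}^{-1}M_{CD}$. *)

theory Defs
  imports "HOL-Analysis.Analysis" "HOL-Library.Landau_Symbols"
begin

definition conj_transpose :: "complex ^ 'n ^ 'm \<Rightarrow> complex ^ 'm ^ 'n"  ("_\<^sup>H" [1000] 999)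
  where "M\<^sup>H = (\<chi> i j. cnj (M $ j $ i))"

definition hermitian :: "complex ^ 'n ^ 'n \<Rightarrow> bool"
  where "hermitian M \<longleftrightarrow> M\<^sup>H = M"

(* For Hermitian M the form below is real, so taking Re loses nothing. *)
definition hermitian_pos_def :: "complex ^ 'n ^ 'n \<Rightarrow> bool"
  where "hermitian_pos_def M \<longleftrightarrow>
    hermitian M \<and> (\<forall>v. v \<noteq> 0 \<longrightarrow> 0 < Re (\<Sum>i\<in>UNIV. cnj (v $ i) * (M *v v) $ i))"

definition eigenvector :: "complex ^ 'n ^ 'n \<Rightarrow> complex \<Rightarrow> complex ^ 'n \<Rightarrow> bool"
  where "eigenvector M k v \<longleftrightarrow> v \<noteq> 0 \<and> M *v v = k *s v"

definition eigenvalue :: "complex ^ 'n ^ 'n \<Rightarrow> complex \<Rightarrow> bool"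
  where "eigenvalue M k \<longleftrightarrow> (\<exists>v. eigenvector M k v)"

(* Smallest and largest eigenvalue; meant for Hermitian matrices, all of whose
   eigenvalues are real. *)
definition lambda_min :: "complex ^ 'n ^ 'n \<Rightarrow> real"
  where "lambda_min M = Min {x. eigenvalue M (complex_of_real x)}"

definition lambda_max :: "complex ^ 'n ^ 'n \<Rightarrow> real"
  where "lambda_max M = Max {x. eigenvalue M (complex_of_real x)}"

(* A set C of indices is presented by an enumeration r :: 'c \<Rightarrow> 'n with
   bij_betw r UNIV C, so that |C| = CARD('c). With such enumerations r of C and
   s of D, submat r s M is the block M_CD and subvec r v is the subvector v_C. *)
definition submat :: "('c \<Rightarrow> 'n) \<Rightarrow> ('d \<Rightarrow> 'n) \<Rightarrow> complex ^ 'n ^ 'n \<Rightarrow> complex ^ 'd ^ 'c"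
  where "submat r s M = (\<chi> i j. M $ r i $ s j)"

definition subvec :: "('c \<Rightarrow> 'n) \<Rightarrow> complex ^ 'n \<Rightarrow> complex ^ 'c"
  where "subvec r v = (\<chi> i. v $ r i)"

(* M / M_CC, for enumerations r of C and s of D and M_CC invertible *)
definition schur_compl ::
    "('c::finite \<Rightarrow> 'n) \<Rightarrow> ('d::finite \<Rightarrow> 'n) \<Rightarrow> complex ^ 'n ^ 'n \<Rightarrow> complex ^ 'd ^ 'd"
  where "schur_compl r s M =
    submat s s M - submat s r M ** matrix_inv (submat r r M) ** submat r s M"

definition ind_diag :: "'n set \<Rightarrow> complex ^ 'n ^ 'n"
  where "ind_diag C = (\<chi> i j. if i = j \<and> i \<in> C then 1 else 0)"

definition Ahat :: "complex ^ 'n ^ 'n \<Rightarrow> real \<Rightarrow> 'n set \<Rightarrow> real \<Rightarrow> complex ^ 'n ^ 'n"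
  where "Ahat S \<xi> C b =
    S + map_matrix (\<lambda>z. \<i> * complex_of_real b * complex_of_real \<xi> * z) (ind_diag C)"

definition Ghat ::
    "complex ^ 'n ^ 'n \<Rightarrow> real \<Rightarrow> 'n set \<Rightarrow> complex ^ 'n ^ 'n \<Rightarrow> real \<Rightarrow> complex ^ 'n ^ 'n"
  where "Ghat S \<xi> C K b = Ahat S \<xi> C b ** K ** (Ahat S \<xi> C b)\<^sup>H"

end

theory Submission
  imports Defs
begin

text \<open>
  For vectors \<open>v\<close> write \<open>w = Ahat\<^sup>H v = S\<^sup>H v - i b \<xi> P v\<close>, so that the Hermitian form of \<open>Ghat\<close> at
  \<open>v\<close> is the form of \<open>K\<close> at \<open>w\<close>.  All three claims follow from the extremal characterisation of the
  largest and smallest eigenvalue, applied to this form; \<open>\<bullet>\<close>, the real inner product on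
  \<open>\<complex>\<^sup>n\<close>, is the real part of the Hermitian one, and a Hermitian form is already real.

  For the largest eigenvalue, the form of \<open>Ghat\<close> on unit vectors is
  \<open>b\<^sup>2 \<xi>\<^sup>2\<close> times the form of \<open>K\<^sub>C\<^sub>C\<close> at \<open>v\<^sub>C\<close>, up to an error linear in \<open>b\<close>, and the maximum of that
  leading term is attained at a vector supported on \<open>C\<close> (\<open>lambda_max_estimate\<close>).

  For the smallest eigenvalue, the idea is that \<open>w\<^sub>D\<close> differs from \<open>(S\<^sub>D\<^sub>D)\<^sup>H v\<^sub>D\<close> by a linear function
  of \<open>v\<^sub>C\<close> alone, independent of \<open>b\<close>, while a tiny \<open>v\<^sub>C\<close> of size \<open>1 / b\<close> suffices to give \<open>w\<^sub>C\<close> any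
  prescribed value.  With \<open>w\<^sub>D\<close> fixed, the least value of the form of \<open>K\<close> is that of the Schur complement at \<open>w\<^sub>D\<close>
  (\<open>schur_compl_form_le\<close>, attained at \<open>min_lift\<close>).  Choosing \<open>v\<^sub>C\<close> optimally for a minimising \<open>v\<^sub>D\<close>
  yields the upper bound \<open>lambda_min_G_upper\<close>.  As a consequence the smallest eigenvalue is bounded,
  so coercivity of \<open>K\<close> bounds \<open>w\<close> at a minimal eigenvector and hence
  \<open>b \<bar>\<xi>\<bar> \<parallel>v\<^sub>C\<parallel>\<close>: this is the claim on eigenvectors
  (\<open>min_eigenvector_block_estimate\<close>).  Finally, with \<open>v\<^sub>C\<close> negligible, the Schur complement inequality
  becomes the matching lower bound \<open>lambda_min_G_lower\<close>.
\<close>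

section \<open>Extreme eigenvalues of a Hermitian matrix\<close>

text \<open>A Cauchy--Schwarz argument: moving from \<open>u\<close> a short way along \<open>- B u\<close> would make the form
  negative unless \<open>B u = 0\<close>.\<close>

lemma nonneg_symmetric_form_null_vector:
  fixes B :: "'a::real_inner \<Rightarrow> 'a"
  assumes lin: "linear B" and sym: "\<And>x y. B x \<bullet> y = x \<bullet> B y"
    and nonneg: "\<And>x. 0 \<le> x \<bullet> B x" and null: "u \<bullet> B u = 0"
  shows "B u = 0"
proof -
  define h where "h = B u"
  define q where "q = h \<bullet> B h"
  \<comment> \<open>The optimal step is \<open>(h \<bullet> h) / q\<close>; enlarging the denominator covers \<open>q = 0\<close>.\<close>
  define t where "t = (h \<bullet> h) / (q + 1)"
  have q0: "q \<ge> 0" unfolding q_def by (rule nonneg)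
  have "(u - t *\<^sub>R h) \<bullet> B (u - t *\<^sub>R h) = u \<bullet> B u - 2 * t * (h \<bullet> h) + t\<^sup>2 * q"
  proof -
    have "u \<bullet> B h = h \<bullet> h" unfolding h_def by (simp add: sym[symmetric])
    then show ?thesis
      by (simp add: linear_diff[OF lin] linear_scale[OF lin] algebra_simps inner_commute
          power2_eq_square q_def flip: h_def)
  qed
  with nonneg[of "u - t *\<^sub>R h"] null have "2 * t * (h \<bullet> h) \<le> t\<^sup>2 * q" by linarith
  moreover have "h \<bullet> h = t * (q + 1)" using q0 by (simp add: t_def)
  ultimately have "t\<^sup>2 * (q + 2) \<le> 0" by (simp add: power2_eq_square algebra_simps)
  then have "t = 0" using q0 by (simp add: mult_le_0_iff)
  then show ?thesis using q0 by (simp add: t_def h_def)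
qed

text \<open>A minimiser of the quadratic form on the compact unit sphere is a null vector of the
  nonnegative form of \<open>T - l\<close>, where \<open>l\<close> is the minimum, hence an eigenvector.\<close>

lemma symmetric_operator_min_eigenvector:
  fixes T :: "'a::euclidean_space \<Rightarrow> 'a"
  assumes lin: "linear T" and sym: "\<And>x y. T x \<bullet> y = x \<bullet> T y"
  obtains u where "norm u = 1" "T u = (u \<bullet> T u) *\<^sub>R u"
    "\<And>v. (u \<bullet> T u) * (v \<bullet> v) \<le> v \<bullet> T v"
proof -
  have "sphere (0::'a) 1 \<noteq> {}" by simp
  moreover have "continuous_on (sphere 0 1) (\<lambda>v. v \<bullet> T v)"
    by (intro continuous_intros linear_continuous_on linear_conv_bounded_linear[THEN iffD1] lin)
  ultimately obtain u where u: "u \<in> sphere 0 1" and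
    min: "\<And>v. v \<in> sphere 0 1 \<Longrightarrow> u \<bullet> T u \<le> v \<bullet> T v"
    using continuous_attains_inf[OF compact_sphere] by blast
  define l where "l = u \<bullet> T u"
  define B where "B v = T v - l *\<^sub>R v" for v
  have linB: "linear B"
    unfolding B_def by (intro linear_compose_sub lin linear_scaleR)
  have le: "l * (v \<bullet> v) \<le> v \<bullet> T v" for v
  proof (cases "v = 0")
    case False
    have "l \<le> (v /\<^sub>R norm v) \<bullet> T (v /\<^sub>R norm v)"
      unfolding l_def by (rule min) (use False in simp)
    also have "\<dots> = (v \<bullet> T v) / (v \<bullet> v)"
      by (simp add: linear_scale[OF lin] divide_simps dot_square_norm power2_eq_square)
    finally show ?thesis using False by (simp add: field_simps)
  qed (simp add: linear_0[OF lin])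
  have "B u = 0"
  proof (rule nonneg_symmetric_form_null_vector[OF linB])
    show "B x \<bullet> y = x \<bullet> B y" for x y by (simp add: B_def algebra_simps sym)
    show "0 \<le> x \<bullet> B x" for x using le[of x] by (simp add: B_def algebra_simps)
    show "u \<bullet> B u = 0" using u by (simp add: B_def l_def algebra_simps dot_square_norm)
  qed
  show ?thesis
  proof (rule that)
    show "norm u = 1" using u by simp
    show "T u = (u \<bullet> T u) *\<^sub>R u" using \<open>B u = 0\<close> by (simp add: B_def l_def)
    show "(u \<bullet> T u) * (v \<bullet> v) \<le> v \<bullet> T v" for v using le by (simp add: l_def)
  qed
qed

text \<open>The real inner product of \<open>complex ^ 'n\<close> is the real part of the Hermitian one.  The real
  Euclidean theory therefore applies to complex matrices as real-linear operators, with the conjugate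
  transpose as adjoint.\<close>

lemma inner_vec_complex: "v \<bullet> w = Re (\<Sum>i\<in>UNIV. cnj (v $ i) * w $ i)"
  for v w :: "complex ^ 'n"
  by (simp add: inner_vec_def inner_complex_def)

lemma inner_conj_transpose: "(M\<^sup>H *v x) \<bullet> y = x \<bullet> (M *v y)"
  for M :: "complex ^ 'n ^ 'm"
proof -
  have "(\<Sum>i\<in>UNIV. cnj ((M\<^sup>H *v x) $ i) * y $ i) = (\<Sum>j\<in>UNIV. cnj (x $ j) * (M *v y) $ j)"
    by (simp add: conj_transpose_def matrix_vector_mult_def sum_distrib_left sum_distrib_right mult_ac)
      (rule sum.swap)
  then show ?thesis by (simp only: inner_vec_complex)
qed

lemma conj_transpose_involution [simp]: "(M\<^sup>H)\<^sup>H = M"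
  by (simp add: conj_transpose_def vec_eq_iff)

lemma hermitian_iff_symmetric_form:
  "hermitian M \<longleftrightarrow> (\<forall>x y. (M *v x) \<bullet> y = x \<bullet> (M *v y))"
proof
  assume R: "\<forall>x y. (M *v x) \<bullet> y = x \<bullet> (M *v y)"
  have "M\<^sup>H *v x = M *v x" for x
    by (rule vector_eq_ldot[THEN iffD1]) (metis R inner_conj_transpose inner_commute)
  then show "hermitian M" unfolding hermitian_def by (simp add: matrix_eq)
qed (metis hermitian_def inner_conj_transpose)

lemma matrix_inv_right_cancel: "invertible M \<Longrightarrow> M *v (matrix_inv M *v x) = x"
  for M :: "complex ^ 'n ^ 'n"
  unfolding matrix_inv_def invertible_def
  by (metis (mono_tags, lifting) matrix_vector_mul_assoc matrix_vector_mul_lid someI_ex)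

lemma of_real_smult_eq_scaleR: "complex_of_real a *s v = a *\<^sub>R v"
  for v :: "complex ^ 'n"
  unfolding vec_eq_iff vector_smult_component vector_scaleR_component by (simp add: scaleR_conv_of_real)

lemma eigenvalue_real_iff:
  "eigenvalue M (complex_of_real k) \<longleftrightarrow> (\<exists>v. v \<noteq> 0 \<and> M *v v = k *\<^sub>R v)"
  by (simp add: eigenvalue_def eigenvector_def of_real_smult_eq_scaleR)

text \<open>Eigenvectors for distinct eigenvalues are orthogonal, and the space has finite dimension.
  Finiteness is what makes the minimum and maximum of the eigenvalue set meaningful.\<close>

lemma hermitian_finite_real_eigenvalues:
  assumes "hermitian M"
  shows "finite {k. eigenvalue M (complex_of_real k)}" (is "finite ?E")
proof -
  have "\<forall>k\<in>?E. \<exists>v. v \<noteq> 0 \<and> M *v v = k *\<^sub>R v" by (simp add: eigenvalue_real_iff)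
  then obtain f where f: "\<And>k. k \<in> ?E \<Longrightarrow> f k \<noteq> 0 \<and> M *v f k = k *\<^sub>R f k" by metis
  have orth: "f k \<bullet> f l = 0" if "k \<in> ?E" "l \<in> ?E" "k \<noteq> l" for k l
  proof -
    have "k * (f k \<bullet> f l) = l * (f k \<bullet> f l)"
      using assms f[OF that(1)] f[OF that(2)]
      by (metis hermitian_iff_symmetric_form inner_scaleR_left inner_scaleR_right)
    then show ?thesis using that by simp
  qed
  have "pairwise orthogonal (f ` ?E)"
    using orth by (auto simp: pairwise_def orthogonal_def)
  then have "finite (f ` ?E)" by (rule pairwise_orthogonal_imp_finite)
  moreover have "inj_on f ?E"
    by (rule inj_onI) (metis f orth inner_eq_zero_iff)
  ultimately show ?thesis by (rule finite_imageD)
qed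

text \<open>The Rayleigh characterisation: the constrained minimiser supplies an eigenvalue that is a
  lower bound for all the others.\<close>

lemma hermitian_lambda_min:
  assumes "hermitian M"
  shows lambda_min_le: "lambda_min M * (norm v)\<^sup>2 \<le> v \<bullet> (M *v v)"
    and lambda_min_attained: "\<exists>u. norm u = 1 \<and> M *v u = lambda_min M *\<^sub>R u"
proof -
  obtain u where u: "norm u = 1" "M *v u = (u \<bullet> (M *v u)) *\<^sub>R u"
    and le: "\<And>v. (u \<bullet> (M *v u)) * (v \<bullet> v) \<le> v \<bullet> (M *v v)"
    using symmetric_operator_min_eigenvector[of "(*v) M"] assms
    by (metis hermitian_iff_symmetric_form matrix_vector_mul_linear)
  have "lambda_min M = u \<bullet> (M *v u)"
    unfolding lambda_min_def
  proof (rule Min_eqI[OF hermitian_finite_real_eigenvalues[OF assms]])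
    show "u \<bullet> (M *v u) \<in> {k. eigenvalue M (complex_of_real k)}"
      using u by (auto simp: eigenvalue_real_iff intro!: exI[of _ u])
  next
    fix k assume "k \<in> {k. eigenvalue M (complex_of_real k)}"
    then obtain v where "v \<noteq> 0" "M *v v = k *\<^sub>R v" by (auto simp: eigenvalue_real_iff)
    with le[of v] show "u \<bullet> (M *v u) \<le> k" by simp
  qed
  with u le show "lambda_min M * (norm v)\<^sup>2 \<le> v \<bullet> (M *v v)"
    "\<exists>u. norm u = 1 \<and> M *v u = lambda_min M *\<^sub>R u"
    by (auto simp: dot_square_norm)
qed

lemma matrix_uminus_mult: "(- M) *v x = - (M *v x)"
  for M :: "complex ^ 'n ^ 'm"
  by (simp add: matrix_vector_mult_def vec_eq_iff sum_negf)

lemma hermitian_uminus: "hermitian M \<Longrightarrow> hermitian (- M)"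
  by (simp add: hermitian_iff_symmetric_form matrix_uminus_mult)

lemma lambda_max_eq_lambda_min_uminus:
  assumes "hermitian M"
  shows "lambda_max M = - lambda_min (- M)"
proof -
  define B where "B = {k. eigenvalue M (complex_of_real k)}"
  have flip: "(- M) *v v = k *\<^sub>R v \<longleftrightarrow> M *v v = (- k) *\<^sub>R v" for k v
    unfolding matrix_uminus_mult scaleR_minus_left by (rule minus_equation_iff[THEN trans]) (rule eq_commute)
  have neg: "{k. eigenvalue (- M) (complex_of_real k)} = uminus ` B"
  proof (intro set_eqI iffI)
    fix k assume "k \<in> {k. eigenvalue (- M) (complex_of_real k)}"
    then have "- k \<in> B" unfolding B_def mem_Collect_eq eigenvalue_real_iff flip .
    then show "k \<in> uminus ` B" by (rule rev_image_eqI) simp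
  next
    fix k assume "k \<in> uminus ` B"
    then have "- k \<in> B" by auto
    then show "k \<in> {k. eigenvalue (- M) (complex_of_real k)}"
      unfolding B_def mem_Collect_eq eigenvalue_real_iff flip .
  qed
  obtain u where "norm u = 1" "M *v u = lambda_min M *\<^sub>R u"
    using lambda_min_attained[OF assms] by blast
  then have "lambda_min M \<in> B"
    by (auto simp: B_def eigenvalue_real_iff intro!: exI[of _ u])
  then have "- Max B = Min (uminus ` B)"
    using hermitian_finite_real_eigenvalues[OF assms] by (intro minus_Max_eq_Min) (auto simp: B_def)
  then show ?thesis
    unfolding lambda_max_def lambda_min_def neg B_def[symmetric] by linarith
qed

lemma hermitian_lambda_max:
  assumes "hermitian M"
  shows lambda_max_ge: "v \<bullet> (M *v v) \<le> lambda_max M * (norm v)\<^sup>2"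
    and lambda_max_attained: "\<exists>u. norm u = 1 \<and> M *v u = lambda_max M *\<^sub>R u"
proof -
  note H = hermitian_uminus[OF assms]
  show "v \<bullet> (M *v v) \<le> lambda_max M * (norm v)\<^sup>2"
    using lambda_min_le[OF H, of v]
    by (simp add: lambda_max_eq_lambda_min_uminus[OF assms] matrix_uminus_mult)
  obtain u where "norm u = 1" "(- M) *v u = lambda_min (- M) *\<^sub>R u"
    using lambda_min_attained[OF H] by blast
  then show "\<exists>u. norm u = 1 \<and> M *v u = lambda_max M *\<^sub>R u"
    by (intro exI[of _ u])
      (metis lambda_max_eq_lambda_min_uminus[OF assms] matrix_uminus_mult minus_minus scaleR_minus_left)
qed

lemma hermitian_pos_def_imp_hermitian: "hermitian_pos_def M \<Longrightarrow> hermitian M"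
  by (simp add: hermitian_pos_def_def)

lemma hermitian_pos_def_pos: "hermitian_pos_def M \<Longrightarrow> v \<noteq> 0 \<Longrightarrow> 0 < v \<bullet> (M *v v)"
  unfolding hermitian_pos_def_def inner_vec_complex by blast

lemma hermitian_pos_defI:
  assumes "hermitian M" "\<And>v. v \<noteq> 0 \<Longrightarrow> 0 < v \<bullet> (M *v v)"
  shows "hermitian_pos_def M"
  using assms unfolding hermitian_pos_def_def inner_vec_complex by blast

lemma pos_def_lambda_min_pos:
  assumes "hermitian_pos_def M" shows "0 < lambda_min M"
proof -
  obtain u where u: "norm u = 1" "M *v u = lambda_min M *\<^sub>R u"
    using lambda_min_attained[OF hermitian_pos_def_imp_hermitian[OF assms]] by blast
  with hermitian_pos_def_pos[OF assms, of u] show ?thesis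
    by (force simp: dot_square_norm)
qed

lemma pos_def_invertible: "hermitian_pos_def M \<Longrightarrow> invertible M"
  unfolding invertible_left_inverse matrix_left_invertible_ker
  by (metis hermitian_pos_def_pos inner_zero_right less_irrefl)


section \<open>Block vectors\<close>

text \<open>The sum form makes this map the adjoint of \<open>subvec r\<close> for every \<open>r\<close>; for injective \<open>r\<close> it places \<open>x\<close> in the coordinates enumerated by \<open>r\<close> and fills up with zeros.
  Together the two maps replace block matrix manipulations.\<close>

definition zero_extend :: "('c::finite \<Rightarrow> 'n) \<Rightarrow> complex ^ 'c \<Rightarrow> complex ^ 'n::finite"
  where "zero_extend r x = (\<chi> j. \<Sum>i\<in>UNIV. if r i = j then x $ i else 0)"

lemma inner_zero_extend: "zero_extend r x \<bullet> v = x \<bullet> subvec r v"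
proof -
  have "zero_extend r x \<bullet> v = (\<Sum>j\<in>UNIV. \<Sum>i\<in>UNIV. if r i = j then x $ i \<bullet> v $ j else 0)"
    by (simp add: zero_extend_def inner_vec_def inner_sum_left if_distrib[of "\<lambda>z. z \<bullet> _"] cong: if_cong)
  also have "\<dots> = (\<Sum>i\<in>UNIV. \<Sum>j\<in>UNIV. if r i = j then x $ i \<bullet> v $ j else 0)"
    by (rule sum.swap)
  also have "\<dots> = x \<bullet> subvec r v"
    by (simp add: subvec_def inner_vec_def)
  finally show ?thesis .
qed

lemma submat_mult: "submat r s M *v x = subvec r (M *v zero_extend s x)"
proof -
  have "(M *v zero_extend s x) $ k = (\<Sum>j\<in>UNIV. M $ k $ s j * x $ j)" for k
  proof -
    have "(M *v zero_extend s x) $ k = (\<Sum>i\<in>UNIV. \<Sum>j\<in>UNIV. if s j = i then M $ k $ i * x $ j else 0)"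
      by (simp add: zero_extend_def matrix_vector_mult_def sum_distrib_left
          if_distrib[of "\<lambda>z. _ * z"] cong: if_cong)
    also have "\<dots> = (\<Sum>j\<in>UNIV. \<Sum>i\<in>UNIV. if s j = i then M $ k $ i * x $ j else 0)"
      by (rule sum.swap)
    finally show ?thesis by simp
  qed
  then show ?thesis
    by (simp add: vec_eq_iff submat_def subvec_def matrix_vector_mult_def)
qed

lemma conj_transpose_submat: "(submat r s M)\<^sup>H = submat s r (M\<^sup>H)"
  by (simp add: conj_transpose_def submat_def)

lemma linear_subvec: "linear (subvec r)"
  by (intro linearI) (simp_all add: subvec_def vec_eq_iff)

lemma linear_zero_extend: "linear (zero_extend r)"
proof (rule linearI)
  show "zero_extend r (x + y) = zero_extend r x + zero_extend r y" for x y
    unfolding zero_extend_def vec_eq_iff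
    by (auto simp: sum.distrib[symmetric] intro!: sum.cong)
  show "zero_extend r (c *\<^sub>R x) = c *\<^sub>R zero_extend r x" for c x
    unfolding zero_extend_def vec_eq_iff
    by (auto simp: scaleR_right.sum intro!: sum.cong)
qed

lemmas subvec_simps = linear_add[OF linear_subvec] linear_diff[OF linear_subvec]
  linear_0[OF linear_subvec] linear_scale[OF linear_subvec]
lemmas zero_extend_simps = linear_add[OF linear_zero_extend] linear_diff[OF linear_zero_extend]
  linear_0[OF linear_zero_extend] linear_scale[OF linear_zero_extend]

lemma subvec_zero_extend: "inj r \<Longrightarrow> subvec r (zero_extend r x) = x"
  by (simp add: subvec_def zero_extend_def inj_eq)

lemma subvec_zero_extend_disjoint:
  assumes "range r \<inter> range s = {}" shows "subvec s (zero_extend r x) = 0"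
proof -
  have "r j \<noteq> s i" for i j using assms by blast
  then show ?thesis by (simp add: subvec_def zero_extend_def vec_eq_iff)
qed

lemma zero_extend_subvec:
  "inj r \<Longrightarrow> zero_extend r (subvec r v) $ k = (if k \<in> range r then v $ k else 0)"
  by (auto simp: subvec_def zero_extend_def inj_eq intro!: sum.neutral)

lemma norm_zero_extend: "inj r \<Longrightarrow> norm (zero_extend r x) = norm x"
  by (simp add: norm_eq_sqrt_inner inner_zero_extend subvec_zero_extend)

lemma norm_subvec_le:
  assumes "inj r" shows "norm (subvec r v) \<le> norm v"
proof -
  have "norm (subvec r v) * norm (subvec r v) = zero_extend r (subvec r v) \<bullet> v"
    by (simp add: inner_zero_extend dot_square_norm flip: power2_eq_square)
  also have "\<dots> \<le> norm (subvec r v) * norm v"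
    using norm_cauchy_schwarz[of "zero_extend r (subvec r v)" v] by (simp add: norm_zero_extend assms)
  finally show ?thesis
    by (cases "subvec r v = 0") simp_all
qed

locale complementary_indices =
  fixes r :: "'c::finite \<Rightarrow> 'n::finite" and s :: "'d::finite \<Rightarrow> 'n"
  assumes inj_r: "inj r" and inj_s: "inj s"
    and disjoint: "range r \<inter> range s = {}" and cover: "range r \<union> range s = UNIV"
begin

lemma subvec_zero_extend_simps [simp]:
  "subvec r (zero_extend r x) = x" "subvec s (zero_extend s y) = y"
  "subvec s (zero_extend r x) = 0" "subvec r (zero_extend s y) = 0"
  using inj_r inj_s disjoint
  by (simp_all add: subvec_zero_extend subvec_zero_extend_disjoint Int_commute)

lemma block_decomposition: "zero_extend r (subvec r v) + zero_extend s (subvec s v) = v"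
  using disjoint cover by (auto simp: vec_eq_iff zero_extend_subvec inj_r inj_s)

lemma block_eqI: "subvec r v = subvec r w \<Longrightarrow> subvec s v = subvec s w \<Longrightarrow> v = w"
  by (metis block_decomposition)

lemma norm_block: "(norm v)\<^sup>2 = (norm (subvec r v))\<^sup>2 + (norm (subvec s v))\<^sup>2"
proof -
  have "v \<bullet> v = (zero_extend r (subvec r v) + zero_extend s (subvec s v)) \<bullet> v"
    by (simp only: block_decomposition)
  then show ?thesis by (simp add: inner_add_left inner_zero_extend flip: dot_square_norm)
qed

lemma subvec_mult:
  "subvec s (M *v v) = submat s s M *v subvec s v + submat s r M *v subvec r v"
proof -
  have "subvec s (M *v (zero_extend r a + zero_extend s b)) = submat s s M *v b + submat s r M *v a" for a b
    by (simp add: matrix_vector_right_distrib subvec_simps submat_mult add.commute)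
  from this[of "subvec r v" "subvec s v"] show ?thesis by (simp only: block_decomposition)
qed

end

section \<open>The Schur complement as a constrained minimum\<close>

lemma pos_def_principal_submat:
  assumes "inj r" "hermitian_pos_def K"
  shows "hermitian_pos_def (submat r r K)"
proof (rule hermitian_pos_defI)
  show "hermitian (submat r r K)"
    using hermitian_pos_def_imp_hermitian[OF assms(2)]
    by (simp add: hermitian_def conj_transpose_submat)
  show "0 < v \<bullet> (submat r r K *v v)" if "v \<noteq> 0" for v
  proof -
    have "zero_extend r v \<noteq> 0" using that norm_zero_extend[OF assms(1), of v] by force
    from hermitian_pos_def_pos[OF assms(2) this]
    show ?thesis by (simp add: inner_zero_extend submat_mult)
  qed
qed

locale pos_def_blocks = complementary_indices r s
  for r :: "'c::finite \<Rightarrow> 'n::finite" and s :: "'d::finite \<Rightarrow> 'n" +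
  fixes K :: "complex ^ 'n ^ 'n"
  assumes pos_def_K: "hermitian_pos_def K"
begin

lemma hermitian_K: "hermitian K"
  by (rule hermitian_pos_def_imp_hermitian[OF pos_def_K])

lemma K_symmetric: "(K *v x) \<bullet> y = x \<bullet> (K *v y)"
  using hermitian_K hermitian_iff_symmetric_form by blast

lemma K_nonneg: "0 \<le> x \<bullet> (K *v x)"
  using hermitian_pos_def_pos[OF pos_def_K, of x] by (cases "x = 0") auto

text \<open>The minimiser of the form of \<open>K\<close> among the vectors whose \<open>s\<close>-block is \<open>z\<close>: its \<open>r\<close>-block is chosen
  so that the \<open>r\<close>-block of the gradient vanishes.\<close>

definition min_lift :: "complex ^ 'd \<Rightarrow> complex ^ 'n"
  where "min_lift z = zero_extend s z
    - zero_extend r (matrix_inv (submat r r K) *v (submat r s K *v z))"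

lemma subvec_min_lift: "subvec s (min_lift z) = z"
  by (simp add: min_lift_def subvec_simps)

lemma K_min_lift: "K *v min_lift z = zero_extend s (schur_compl r s K *v z)"
proof (rule block_eqI)
  have "invertible (submat r r K)"
    by (rule pos_def_invertible[OF pos_def_principal_submat[OF inj_r pos_def_K]])
  then show "subvec r (K *v min_lift z) = subvec r (zero_extend s (schur_compl r s K *v z))"
    by (simp add: min_lift_def matrix_vector_mult_diff_distrib subvec_simps matrix_inv_right_cancel
        flip: submat_mult)
  show "subvec s (K *v min_lift z) = subvec s (zero_extend s (schur_compl r s K *v z))"
    by (simp add: min_lift_def schur_compl_def algebra_simps subvec_simps
        flip: submat_mult matrix_vector_mul_assoc)
qed

lemma form_min_lift: "min_lift y \<bullet> (K *v min_lift z) = y \<bullet> (schur_compl r s K *v z)"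
  unfolding K_min_lift
  by (subst (1 2) inner_commute) (simp only: inner_zero_extend subvec_min_lift)

text \<open>The difference \<open>d\<close> between \<open>w\<close> and the lift of its \<open>s\<close>-block lives on the \<open>r\<close>-block, where \<open>K\<close>
  applied to the lift vanishes; hence there is no cross term and \<open>d\<close> contributes a nonnegative amount.\<close>

lemma schur_compl_form_le: "subvec s w \<bullet> (schur_compl r s K *v subvec s w) \<le> w \<bullet> (K *v w)"
proof -
  define l where "l = min_lift (subvec s w)"
  define d where "d = w - l"
  have "subvec s d = 0" by (simp add: d_def l_def subvec_simps subvec_min_lift)
  then have "d \<bullet> (K *v l) = 0"
    unfolding l_def K_min_lift by (subst inner_commute) (simp add: inner_zero_extend)
  moreover have "l \<bullet> (K *v d) = d \<bullet> (K *v l)" by (metis K_symmetric inner_commute)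
  moreover have "w = l + d" by (simp add: d_def)
  ultimately have "w \<bullet> (K *v w) = l \<bullet> (K *v l) + d \<bullet> (K *v d)"
    by (simp add: algebra_simps)
  with K_nonneg[of d] show ?thesis by (simp add: l_def form_min_lift)
qed

text \<open>Both symmetry and positivity are inherited from \<open>K\<close> through \<open>form_min_lift\<close>, which avoids
  computing with the inverse of the block.\<close>

lemma pos_def_schur_compl: "hermitian_pos_def (schur_compl r s K)"
proof (rule hermitian_pos_defI)
  show "hermitian (schur_compl r s K)"
    unfolding hermitian_iff_symmetric_form
    by (metis form_min_lift K_symmetric inner_commute)
  show "0 < z \<bullet> (schur_compl r s K *v z)" if "z \<noteq> 0" for z
  proof -
    have "min_lift z \<noteq> 0" using that subvec_min_lift[of z] by (auto simp: subvec_simps)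
    from hermitian_pos_def_pos[OF pos_def_K this] show ?thesis by (simp add: form_min_lift)
  qed
qed

end

section \<open>Congruence and the penalised matrix\<close>

lemma conj_transpose_mult: "(A ** B)\<^sup>H = B\<^sup>H ** A\<^sup>H"
  by (simp add: conj_transpose_def matrix_matrix_mult_def mult.commute)

lemma congruence_form: "v \<bullet> ((A ** M ** A\<^sup>H) *v v) = (A\<^sup>H *v v) \<bullet> (M *v (A\<^sup>H *v v))"
  by (simp add: inner_conj_transpose flip: matrix_vector_mul_assoc)

lemma hermitian_congruence: "hermitian M \<Longrightarrow> hermitian (A ** M ** A\<^sup>H)"
  by (simp add: hermitian_def conj_transpose_mult matrix_mul_assoc)

lemma conj_transpose_mat_1: "(mat 1)\<^sup>H = mat 1"
  by (simp add: conj_transpose_def mat_def vec_eq_iff)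

lemma pos_def_congruence:
  assumes "hermitian_pos_def M" "invertible A"
  shows "hermitian_pos_def (A ** M ** A\<^sup>H)"
proof (rule hermitian_pos_defI)
  show "hermitian (A ** M ** A\<^sup>H)"
    by (intro hermitian_congruence hermitian_pos_def_imp_hermitian assms)
  obtain B where "A ** B = mat 1" using assms(2) invertible_def by blast
  then have "B\<^sup>H ** A\<^sup>H = mat 1"
    by (simp add: conj_transpose_mat_1 flip: conj_transpose_mult)
  then have "A\<^sup>H *v v \<noteq> 0" if "v \<noteq> 0" for v
    using that by (metis matrix_left_invertible_ker)
  then show "0 < v \<bullet> ((A ** M ** A\<^sup>H) *v v)" if "v \<noteq> 0" for v
    unfolding congruence_form using that assms(1) by (intro hermitian_pos_def_pos)
qed

lemma Ahat_conj_transpose_mult: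
  assumes "inj r"
  shows "(Ahat S \<xi> (range r) b)\<^sup>H *v v
    = S\<^sup>H *v v - b *\<^sub>R ((\<i> * complex_of_real \<xi>) *s zero_extend r (subvec r v))"
proof -
  have "((Ahat S \<xi> (range r) b)\<^sup>H *v v) $ k
    = (S\<^sup>H *v v) $ k - complex_of_real b * (\<i> * complex_of_real \<xi> * zero_extend r (subvec r v) $ k)" for k
  proof -
    have "cnj (Ahat S \<xi> (range r) b $ j $ k) * v $ j = cnj (S $ j $ k) * v $ j
      + (if j = k then - (\<i> * b * \<xi>) * (if k \<in> range r then v $ k else 0) else 0)" for j
      by (simp add: Ahat_def ind_diag_def map_matrix_def algebra_simps)
    then have "((Ahat S \<xi> (range r) b)\<^sup>H *v v) $ k = (S\<^sup>H *v v) $ k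
      - (\<i> * b * \<xi>) * (if k \<in> range r then v $ k else 0)"
      by (simp add: conj_transpose_def matrix_vector_mult_def sum.distrib)
    then show ?thesis by (simp add: zero_extend_subvec assms)
  qed
  then show ?thesis
    unfolding vec_eq_iff vector_minus_component vector_scaleR_component vector_smult_component
    by (simp add: scaleR_conv_of_real)
qed

lemma inner_smult_smult: "(c *s x) \<bullet> (c *s y) = (cmod c)\<^sup>2 * (x \<bullet> y)"
  for x y :: "complex ^ 'n"
proof -
  have "(c * a) \<bullet> (c * d) = (cmod c)\<^sup>2 * (a \<bullet> d)" for a d
    by (simp add: inner_complex_def cmod_power2) (simp add: power2_eq_square algebra_simps)
  then show ?thesis by (simp add: inner_vec_def sum_distrib_left)
qed

lemma norm_smult: "norm (c *s x) = cmod c * norm x"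
  for x :: "complex ^ 'n"
  by (simp add: norm_eq_sqrt_inner inner_smult_smult real_sqrt_mult)

lemma matrix_vector_mult_bound:
  fixes M :: "complex ^ 'n ^ 'm"
  obtains c where "c > 0" "\<And>x. norm (M *v x) \<le> c * norm x"
  using bounded_linear.pos_bounded[OF matrix_vector_mul_bounded_linear[of M]]
  by (metis mult.commute)

lemma matrix_vector_mult_scaleR_complex: "M *v (a *\<^sub>R x) = a *\<^sub>R (M *v x)"
  for M :: "complex ^ 'n ^ 'm"
  by (rule linear_scale) simp

lemma tendsto_one_over_at_top: "((\<lambda>b::real. 1 / b) \<longlongrightarrow> 0) at_top"
  by (rule tendsto_divide_0[OF tendsto_const filterlim_at_top_imp_at_infinity[OF filterlim_ident]])

locale penalized_congruence = pos_def_blocks r s K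
  for r :: "'c::finite \<Rightarrow> 'n::finite" and s :: "'d::finite \<Rightarrow> 'n" and K :: "complex ^ 'n ^ 'n" +
  fixes S :: "complex ^ 'n ^ 'n" and \<xi> :: real
  assumes invertible_S: "invertible (submat s s S)" and xi: "\<xi> \<noteq> 0"
begin

abbreviation G :: "real \<Rightarrow> complex ^ 'n ^ 'n"
  where "G b \<equiv> Ghat S \<xi> (range r) K b"

definition limit_matrix :: "complex ^ 'd ^ 'd"
  where "limit_matrix = submat s s S ** schur_compl r s K ** (submat s s S)\<^sup>H"

definition penalty :: "complex ^ 'n \<Rightarrow> complex ^ 'n"
  where "penalty v = (\<i> * complex_of_real \<xi>) *s zero_extend r (subvec r v)"

text \<open>By \<open>Ahat_conj_transpose_mult\<close> this is \<open>(Ahat S \<xi> (range r) b)\<^sup>H *v v\<close>, with the growth in \<open>b\<close> isolated.\<close>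

definition adjoint_image :: "real \<Rightarrow> complex ^ 'n \<Rightarrow> complex ^ 'n"
  where "adjoint_image b v = S\<^sup>H *v v - b *\<^sub>R penalty v"

lemma G_form: "v \<bullet> (G b *v v) = adjoint_image b v \<bullet> (K *v adjoint_image b v)"
  by (simp add: Ghat_def congruence_form Ahat_conj_transpose_mult[OF inj_r] adjoint_image_def penalty_def)

lemma hermitian_G: "hermitian (G b)"
  unfolding Ghat_def by (rule hermitian_congruence[OF hermitian_K])

lemma norm_penalty: "norm (penalty v) = \<bar>\<xi>\<bar> * norm (subvec r v)"
  by (simp add: penalty_def norm_smult norm_mult norm_zero_extend inj_r)

lemma subvec_penalty: "subvec s (penalty v) = 0"
  using subvec_zero_extend_simps(3)[of "subvec r v"]
  by (simp add: penalty_def subvec_def vec_eq_iff)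

lemma penalty_form:
  "penalty v \<bullet> (K *v penalty v) = \<xi>\<^sup>2 * (subvec r v \<bullet> (submat r r K *v subvec r v))"
  by (simp add: penalty_def vector_scalar_commute inner_smult_smult norm_mult
      inner_zero_extend submat_mult)

lemma pos_def_limit_matrix: "hermitian_pos_def limit_matrix"
  unfolding limit_matrix_def by (rule pos_def_congruence[OF pos_def_schur_compl invertible_S])

section \<open>The largest eigenvalue\<close>

lemma lambda_max_K_pos: "0 < lambda_max (submat r r K)"
proof -
  note pd = pos_def_principal_submat[OF inj_r pos_def_K]
  obtain u where "norm u = 1" "submat r r K *v u = lambda_max (submat r r K) *\<^sub>R u"
    using lambda_max_attained[OF hermitian_pos_def_imp_hermitian[OF pd]] by blast
  with hermitian_pos_def_pos[OF pd, of u] show ?thesis by (force simp: dot_square_norm)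
qed

text \<open>Expanding the form of \<open>K\<close> at \<open>S\<^sup>H v - b penalty v\<close> leaves, besides the quadratic term in \<open>b\<close>, a cross
  term linear in \<open>b\<close> and a constant term; both coefficients are bounded on the unit sphere.\<close>

lemma lambda_max_estimate:
  obtains c where
    "\<And>b. 1 \<le> b \<Longrightarrow> \<bar>lambda_max (G b) - b\<^sup>2 * \<xi>\<^sup>2 * lambda_max (submat r r K)\<bar> \<le> c * b"
proof -
  define \<mu> where "\<mu> = lambda_max (submat r r K)"
  note hK = hermitian_pos_def_imp_hermitian[OF pos_def_principal_submat[OF inj_r pos_def_K]]
  obtain \<sigma> where \<sigma>: "\<sigma> > 0" "\<And>x. norm (S\<^sup>H *v x) \<le> \<sigma> * norm x"
    using matrix_vector_mult_bound[of "S\<^sup>H"] by blast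
  obtain \<kappa> where \<kappa>: "\<kappa> > 0" "\<And>x. norm (K *v x) \<le> \<kappa> * norm x"
    using matrix_vector_mult_bound[of K] by blast
  define c where "c = 2 * (\<bar>\<xi>\<bar> * (\<kappa> * \<sigma>)) + \<sigma> * (\<kappa> * \<sigma>)"
  define q where "q v = \<xi>\<^sup>2 * (subvec r v \<bullet> (submat r r K *v subvec r v))" for v
  have dev: "\<bar>v \<bullet> (G b *v v) - b\<^sup>2 * q v\<bar> \<le> c * b" if "norm v = 1" "1 \<le> b" for v b
  proof -
    define a where "a = S\<^sup>H *v v"
    have a: "norm a \<le> \<sigma>" using \<sigma>(2)[of v] that by (simp add: a_def)
    have Ka: "norm (K *v a) \<le> \<kappa> * \<sigma>"
      using \<kappa>(2)[of a] mult_left_mono[OF a, of \<kappa>] \<kappa>(1) by linarith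
    have p: "norm (penalty v) \<le> \<bar>\<xi>\<bar>"
      using norm_subvec_le[OF inj_r, of v] that by (simp add: norm_penalty mult_left_le)
    have "a \<bullet> (K *v penalty v) = penalty v \<bullet> (K *v a)"
      by (metis K_symmetric inner_commute)
    then have "v \<bullet> (G b *v v) - b\<^sup>2 * q v = a \<bullet> (K *v a) - 2 * b * (penalty v \<bullet> (K *v a))"
      by (simp add: G_form adjoint_image_def q_def a_def[symmetric] penalty_form[of v]
          matrix_vector_mult_diff_distrib matrix_vector_mult_scaleR_complex
          inner_diff_left inner_diff_right power2_eq_square algebra_simps)
    moreover have "\<bar>a \<bullet> (K *v a)\<bar> \<le> \<sigma> * (\<kappa> * \<sigma>)"
      using Cauchy_Schwarz_ineq2[of a "K *v a"] mult_mono[OF a Ka] \<sigma>(1) by simp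
    moreover have "\<bar>penalty v \<bullet> (K *v a)\<bar> \<le> \<bar>\<xi>\<bar> * (\<kappa> * \<sigma>)"
      using Cauchy_Schwarz_ineq2[of "penalty v" "K *v a"] mult_mono[OF p Ka] by simp
    then have "\<bar>2 * b * (penalty v \<bullet> (K *v a))\<bar> \<le> 2 * b * (\<bar>\<xi>\<bar> * (\<kappa> * \<sigma>))"
      using that by (simp add: abs_mult)
    moreover have "\<sigma> * (\<kappa> * \<sigma>) \<le> \<sigma> * (\<kappa> * \<sigma>) * b"
      using that \<sigma>(1) \<kappa>(1) by simp
    ultimately show ?thesis by (simp add: c_def algebra_simps)
  qed
  show ?thesis
  proof (rule that)
    fix b :: real assume b: "1 \<le> b"
    obtain u where u: "norm u = 1" "G b *v u = lambda_max (G b) *\<^sub>R u"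
      using lambda_max_attained[OF hermitian_G] by blast
    have "subvec r u \<bullet> (submat r r K *v subvec r u) \<le> \<mu> * (norm (subvec r u))\<^sup>2"
      unfolding \<mu>_def by (rule lambda_max_ge[OF hK])
    also have "\<dots> \<le> \<mu>"
      using norm_subvec_le[OF inj_r, of u] u lambda_max_K_pos
      by (simp add: \<mu>_def mult_left_le power_le_one)
    finally have "b\<^sup>2 * q u \<le> b\<^sup>2 * (\<xi>\<^sup>2 * \<mu>)"
      unfolding q_def by (intro mult_left_mono) auto
    moreover have "u \<bullet> (G b *v u) = lambda_max (G b)" using u by (simp add: dot_square_norm)
    ultimately have upper: "lambda_max (G b) \<le> b\<^sup>2 * \<xi>\<^sup>2 * \<mu> + c * b"
      using dev[OF u(1) b] by (simp add: mult.assoc)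
    \<comment> \<open>A top eigenvector of the block, extended by zeros, is a test vector for the lower bound.\<close>
    obtain x where x: "norm x = 1" "submat r r K *v x = \<mu> *\<^sub>R x"
      unfolding \<mu>_def using lambda_max_attained[OF hK] by blast
    define e where "e = zero_extend r x"
    have e: "norm e = 1" using x by (simp add: e_def norm_zero_extend inj_r)
    have "q e = \<xi>\<^sup>2 * \<mu>" using x by (simp add: q_def e_def dot_square_norm)
    moreover have "e \<bullet> (G b *v e) \<le> lambda_max (G b)"
      using lambda_max_ge[OF hermitian_G, of e b] e by simp
    ultimately have lower: "b\<^sup>2 * \<xi>\<^sup>2 * \<mu> - c * b \<le> lambda_max (G b)"
      using dev[OF e b] by (simp add: mult.assoc)
    show "\<bar>lambda_max (G b) - b\<^sup>2 * \<xi>\<^sup>2 * lambda_max (submat r r K)\<bar> \<le> c * b"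
      using upper lower by (simp add: \<mu>_def abs_le_iff)
  qed
qed

section \<open>The smallest eigenvalue\<close>

text \<open>The test vector is a minimal eigenvector \<open>x\<close> of the limit matrix in the \<open>s\<close>-block and
  \<open>y / b\<close> in the \<open>r\<close>-block.  The factor \<open>b\<close> of the penalty cancels \<open>1 / b\<close>, so \<open>y\<close> can be chosen to steer
  the adjoint image to the minimising lift \<open>w\<close>, up to an error of order \<open>1 / b\<close>.  The form at the test
  vector then tends to the form of \<open>K\<close> at \<open>w\<close>, which is the claimed limit.\<close>

lemma lambda_min_G_upper:
  obtains f where "(f \<longlongrightarrow> lambda_min limit_matrix) at_top"
    "eventually (\<lambda>b. lambda_min (G b) \<le> f b) at_top"
proof -
  obtain x where x: "norm x = 1" "limit_matrix *v x = lambda_min limit_matrix *\<^sub>R x"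
    using lambda_min_attained[OF hermitian_pos_def_imp_hermitian[OF pos_def_limit_matrix]] by blast
  define z where "z = (submat s s S)\<^sup>H *v x"
  define w where "w = min_lift z"
  define y where "y = (1 / (\<i> * complex_of_real \<xi>)) *s subvec r (S\<^sup>H *v zero_extend s x - w)"
  define t where "t = S\<^sup>H *v zero_extend r y"
  define v where "v b = zero_extend s x + (1 / b) *\<^sub>R zero_extend r y" for b
  have ww: "w \<bullet> (K *v w) = lambda_min limit_matrix"
  proof -
    have "x \<bullet> (limit_matrix *v x) = w \<bullet> (K *v w)"
      unfolding limit_matrix_def congruence_form w_def form_min_lift z_def ..
    then show ?thesis using x by (simp add: dot_square_norm)
  qed
  have pen: "penalty (zero_extend r y) = S\<^sup>H *v zero_extend s x - w"
  proof (rule block_eqI)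
    have sub_smult: "subvec q (c *s a) = c *s subvec q a" for q :: "'e::finite \<Rightarrow> 'n" and c a
      by (simp add: subvec_def vec_eq_iff)
    show "subvec r (penalty (zero_extend r y)) = subvec r (S\<^sup>H *v zero_extend s x - w)"
      using xi by (simp add: penalty_def sub_smult y_def)
    show "subvec s (penalty (zero_extend r y)) = subvec s (S\<^sup>H *v zero_extend s x - w)"
      unfolding w_def z_def
      by (simp add: penalty_def sub_smult subvec_simps subvec_min_lift conj_transpose_submat submat_mult)
  qed
  have adjoint_image_v: "adjoint_image b (v b) = w + (1 / b) *\<^sub>R t" if "b > 0" for b
  proof -
    have "penalty (v b) = (1 / b) *\<^sub>R penalty (zero_extend r y)"
      by (simp add: penalty_def v_def subvec_simps zero_extend_simps vec_eq_iff)
    then show ?thesis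
      using that by (simp add: adjoint_image_def pen v_def t_def matrix_vector_right_distrib
          matrix_vector_mult_scaleR_complex)
  qed
  define f where "f b = (w + (1 / b) *\<^sub>R t) \<bullet> (K *v (w + (1 / b) *\<^sub>R t))" for b
  show ?thesis
  proof (rule that)
    have "isCont (\<lambda>h. (w + h *\<^sub>R t) \<bullet> (K *v (w + h *\<^sub>R t))) 0"
      by (intro continuous_intros bounded_linear.isCont[OF matrix_vector_mul_bounded_linear])
    from isCont_tendsto_compose[OF this tendsto_one_over_at_top]
    show "(f \<longlongrightarrow> lambda_min limit_matrix) at_top" by (simp add: f_def[abs_def] ww)
  next
    have "lambda_min (G b) \<le> f b" if b: "0 < b" for b
    proof -
      obtain u where "norm u = 1" "G b *v u = lambda_min (G b) *\<^sub>R u"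
        using lambda_min_attained[OF hermitian_G] by blast
      then have nonneg: "0 \<le> lambda_min (G b)"
        using G_form[of u b] K_nonneg[of "adjoint_image b u"] by (simp add: dot_square_norm)
      \<comment> \<open>The test vector has norm at least 1, so its form bounds the eigenvalue from above
          because the eigenvalue is nonnegative.\<close>
      have "subvec s (v b) = x" by (simp add: v_def subvec_simps)
      then have "1 \<le> (norm (v b))\<^sup>2" using norm_block[of "v b"] x by simp
      then have "lambda_min (G b) \<le> lambda_min (G b) * (norm (v b))\<^sup>2"
        using nonneg by (simp add: mult_le_cancel_left1)
      also have "\<dots> \<le> v b \<bullet> (G b *v v b)" by (rule lambda_min_le[OF hermitian_G])
      also have "\<dots> = f b" by (simp add: G_form adjoint_image_v[OF b] f_def)
      finally show ?thesis .
    qed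
    then show "eventually (\<lambda>b. lambda_min (G b) \<le> f b) at_top"
      using eventually_gt_at_top[of 0] by (rule eventually_mono[rotated])
  qed
qed

text \<open>By the upper bound the eigenvalue is eventually below a constant \<open>B\<close>, so coercivity of \<open>K\<close> bounds
  the adjoint image of a unit eigenvector.  As \<open>S\<^sup>H v\<close> is bounded as well, so is \<open>b penalty v\<close>, whose norm is
  \<open>b \<bar>\<xi>\<bar>\<close> times the norm of the \<open>r\<close>-block.\<close>

lemma min_eigenvector_block_estimate:
  obtains c where "0 \<le> c" "eventually (\<lambda>b. \<forall>v. norm v = 1 \<longrightarrow> G b *v v = lambda_min (G b) *\<^sub>R v \<longrightarrow>
    norm (subvec r v) \<le> c / b) at_top"
proof -
  define \<kappa> where "\<kappa> = lambda_min K"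
  have \<kappa>: "\<kappa> > 0" unfolding \<kappa>_def by (rule pos_def_lambda_min_pos[OF pos_def_K])
  obtain \<sigma> where \<sigma>: "\<sigma> > 0" "\<And>x. norm (S\<^sup>H *v x) \<le> \<sigma> * norm x"
    using matrix_vector_mult_bound[of "S\<^sup>H"] by blast
  define B where "B = lambda_min limit_matrix + 1"
  have B: "B > 0" using pos_def_lambda_min_pos[OF pos_def_limit_matrix] by (simp add: B_def)
  obtain f where f: "(f \<longlongrightarrow> lambda_min limit_matrix) at_top" "eventually (\<lambda>b. lambda_min (G b) \<le> f b) at_top"
    by (rule lambda_min_G_upper)
  define c where "c = (\<sigma> + sqrt (B / \<kappa>)) / \<bar>\<xi>\<bar>"
  have "eventually (\<lambda>b. f b < B) at_top" by (rule order_tendstoD(2)[OF f(1)]) (simp add: B_def)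
  then have ev: "eventually (\<lambda>b. \<forall>v. norm v = 1 \<longrightarrow> G b *v v = lambda_min (G b) *\<^sub>R v \<longrightarrow>
    norm (subvec r v) \<le> c / b) at_top"
    using f(2) eventually_gt_at_top[of 0]
  proof eventually_elim
    case (elim b)
    show ?case
    proof (intro allI impI)
      fix v assume v: "norm v = 1" "G b *v v = lambda_min (G b) *\<^sub>R v"
      have "\<kappa> * (norm (adjoint_image b v))\<^sup>2 \<le> adjoint_image b v \<bullet> (K *v adjoint_image b v)"
        unfolding \<kappa>_def by (rule lambda_min_le[OF hermitian_K])
      also have "\<dots> = lambda_min (G b)" using v by (simp add: dot_square_norm flip: G_form)
      also have "\<dots> \<le> B" using elim by simp
      finally have "(norm (adjoint_image b v))\<^sup>2 \<le> B / \<kappa>" using \<kappa> by (simp add: field_simps)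
      then have image_bound: "norm (adjoint_image b v) \<le> sqrt (B / \<kappa>)" by (rule real_le_rsqrt)
      have "b * (\<bar>\<xi>\<bar> * norm (subvec r v)) = norm (S\<^sup>H *v v - adjoint_image b v)"
        using elim by (simp add: adjoint_image_def norm_penalty)
      also have "\<dots> \<le> \<sigma> + sqrt (B / \<kappa>)"
        using norm_triangle_ineq4[of "S\<^sup>H *v v" "adjoint_image b v"] \<sigma>(2)[of v] image_bound v by simp
      finally show "norm (subvec r v) \<le> c / b"
        using elim xi by (simp add: c_def field_simps)
    qed
  qed
  have "0 \<le> c" using \<sigma>(1) \<kappa> B by (simp add: c_def)
  then show ?thesis using ev by (rule that)
qed

text \<open>At a minimal eigenvector \<open>u\<close>, the \<open>s\<close>-block of the adjoint image is \<open>p + q\<close> with \<open>p\<close> from the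
  \<open>s\<close>-block of \<open>u\<close> and \<open>q\<close> from its small \<open>r\<close>-block.  The Schur complement bounds the eigenvalue from
  below by its form at \<open>p + q\<close>; the form at \<open>p\<close> is a form of the limit matrix, and the part
  containing \<open>q\<close> costs at most order \<open>1 / b\<close>.\<close>

lemma lambda_min_G_lower:
  obtains g where "(g \<longlongrightarrow> lambda_min limit_matrix) at_top"
    "eventually (\<lambda>b. g b \<le> lambda_min (G b)) at_top"
proof -
  define L where "L = lambda_min limit_matrix"
  have L: "L > 0" unfolding L_def by (rule pos_def_lambda_min_pos[OF pos_def_limit_matrix])
  define \<Sigma> where "\<Sigma> = schur_compl r s K"
  define T where "T = (submat s s S)\<^sup>H"
  define N where "N = submat s r (S\<^sup>H)"
  obtain c where c: "0 \<le> c" "eventually (\<lambda>b. \<forall>v. norm v = 1 \<longrightarrow> G b *v v = lambda_min (G b) *\<^sub>R v \<longrightarrow>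
    norm (subvec r v) \<le> c / b) at_top"
    by (rule min_eigenvector_block_estimate)
  obtain \<nu> where \<nu>: "\<nu> > 0" "\<And>x. norm (N *v x) \<le> \<nu> * norm x"
    using matrix_vector_mult_bound[of N] by blast
  obtain \<tau> where \<tau>: "\<tau> > 0" "\<And>x. norm ((\<Sigma> ** T) *v x) \<le> \<tau> * norm x"
    using matrix_vector_mult_bound[of "\<Sigma> ** T"] by blast
  define g where "g b = L * (1 - (c / b)\<^sup>2) - 2 * (\<nu> * (c / b) * \<tau>)" for b
  have h\<Sigma>: "(\<Sigma> *v x) \<bullet> y = x \<bullet> (\<Sigma> *v y)" for x y
    using hermitian_pos_def_imp_hermitian[OF pos_def_schur_compl]
    unfolding hermitian_iff_symmetric_form \<Sigma>_def by blast
  have nonneg: "0 \<le> x \<bullet> (\<Sigma> *v x)" for x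
    using hermitian_pos_def_pos[OF pos_def_schur_compl, of x] by (cases "x = 0") (auto simp: \<Sigma>_def)
  show ?thesis
  proof (rule that)
    have "((\<lambda>b::real. c * (1 / b)) \<longlongrightarrow> 0) at_top"
      using tendsto_mult_right_zero[OF tendsto_one_over_at_top] .
    then have "((\<lambda>b::real. c / b) \<longlongrightarrow> 0) at_top" by simp
    then have "(g \<longlongrightarrow> L * (1 - 0\<^sup>2) - 2 * (\<nu> * 0 * \<tau>)) at_top"
      unfolding g_def by (intro tendsto_intros)
    then show "(g \<longlongrightarrow> lambda_min limit_matrix) at_top" by (simp add: L_def)
  next
    show "eventually (\<lambda>b. g b \<le> lambda_min (G b)) at_top"
      using c(2) eventually_gt_at_top[of 0]
    proof eventually_elim
      case (elim b)
      obtain u where u: "norm u = 1" "G b *v u = lambda_min (G b) *\<^sub>R u"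
        using lambda_min_attained[OF hermitian_G] by blast
      define \<delta> where "\<delta> = norm (subvec r u)"
      define d where "d = subvec s u"
      have \<delta>: "0 \<le> \<delta>" "\<delta> \<le> c / b" using elim u by (auto simp: \<delta>_def)
      have d: "(norm d)\<^sup>2 = 1 - \<delta>\<^sup>2" using norm_block[of u] u by (simp add: \<delta>_def d_def)
      have "norm d \<le> 1" using norm_subvec_le[OF inj_s, of u] u by (simp add: d_def)
      define p where "p = T *v d"
      define q where "q = N *v subvec r u"
      have q: "norm q \<le> \<nu> * (c / b)"
        using \<nu>(2)[of "subvec r u"] mult_left_mono[OF \<delta>(2), of \<nu>] \<nu>(1) by (simp add: q_def \<delta>_def)
      have \<Sigma>p: "norm (\<Sigma> *v p) \<le> \<tau>"
        using order_trans[OF \<tau>(2)[of d] mult_left_mono[OF \<open>norm d \<le> 1\<close>, of \<tau>]] \<tau>(1)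
        by (simp add: p_def matrix_vector_mul_assoc)
      have "subvec s (adjoint_image b u) = p + q"
        using subvec_mult[of "S\<^sup>H" u]
        by (simp add: adjoint_image_def subvec_simps subvec_penalty p_def q_def d_def T_def N_def
            conj_transpose_submat)
      have "L * (norm d)\<^sup>2 \<le> d \<bullet> (limit_matrix *v d)"
        unfolding L_def
        by (rule lambda_min_le[OF hermitian_pos_def_imp_hermitian[OF pos_def_limit_matrix]])
      also have "\<dots> = p \<bullet> (\<Sigma> *v p)"
        unfolding limit_matrix_def congruence_form p_def T_def \<Sigma>_def ..
      finally have main: "L * (norm d)\<^sup>2 \<le> p \<bullet> (\<Sigma> *v p)" .
      have cross: "\<bar>q \<bullet> (\<Sigma> *v p)\<bar> \<le> \<nu> * (c / b) * \<tau>"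
        using Cauchy_Schwarz_ineq2[of q "\<Sigma> *v p"] mult_mono[OF q \<Sigma>p] \<nu>(1) c(1) elim by simp
      have "L * \<delta>\<^sup>2 \<le> L * (c / b)\<^sup>2"
        using \<delta> L by (intro mult_left_mono power_mono) auto
      then have "g b \<le> L * (norm d)\<^sup>2 - 2 * (\<nu> * (c / b) * \<tau>)"
        by (simp add: g_def d algebra_simps)
      also have "\<dots> \<le> p \<bullet> (\<Sigma> *v p) + 2 * (q \<bullet> (\<Sigma> *v p)) + q \<bullet> (\<Sigma> *v q)"
        using main cross nonneg[of q] by linarith
      also have "\<dots> = (p + q) \<bullet> (\<Sigma> *v (p + q))"
      proof -
        have "p \<bullet> (\<Sigma> *v q) = q \<bullet> (\<Sigma> *v p)" by (metis h\<Sigma> inner_commute)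
        then show ?thesis by (simp add: matrix_vector_right_distrib inner_add_left inner_add_right)
      qed
      also have "\<dots> \<le> adjoint_image b u \<bullet> (K *v adjoint_image b u)"
        using schur_compl_form_le[of "adjoint_image b u"] \<open>subvec s (adjoint_image b u) = p + q\<close> by (simp add: \<Sigma>_def)
      also have "\<dots> = lambda_min (G b)" using u by (simp add: dot_square_norm flip: G_form)
      finally show "g b \<le> lambda_min (G b)" .
    qed
  qed
qed

end

section \<open>The eigenvalue asymptotics\<close>

theorem corollary4p3:
  fixes S K :: "complex ^ 'n ^ 'n"
    and C D :: "'n set"
    and r :: "'c::finite \<Rightarrow> 'n" and s :: "'d::finite \<Rightarrow> 'n"
    and \<xi> :: real
  assumes "C \<union> D = UNIV" and "C \<inter> D = {}"
    and "bij_betw r UNIV C" and "bij_betw s UNIV D"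
    and "invertible (submat s s S)"
    and "\<xi> \<noteq> 0"
    and "hermitian_pos_def K"
  shows "(\<exists>\<epsilon> :: real \<Rightarrow> real. \<epsilon> \<in> O[at_top](\<lambda>b. 1 / b) \<and>
            (\<forall>b>0. lambda_max (Ghat S \<xi> C K b) =
                    b\<^sup>2 * \<xi>\<^sup>2 * lambda_max (submat r r K) * (1 + \<epsilon> b)))
       \<and> ((\<lambda>b. lambda_min (Ghat S \<xi> C K b)) \<longlongrightarrow>
            lambda_min (submat s s S ** schur_compl r s K ** (submat s s S)\<^sup>H)) at_top
       \<and> 0 < lambda_min (submat s s S ** schur_compl r s K ** (submat s s S)\<^sup>H)
       \<and> (\<forall>v :: real \<Rightarrow> complex ^ 'n.
            (\<forall>b>0. norm (v b) = 1 \<and>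
               eigenvector (Ghat S \<xi> C K b)
                 (complex_of_real (lambda_min (Ghat S \<xi> C K b))) (v b)) \<longrightarrow>
            (\<lambda>b. norm (subvec r (v b))) \<in> O[at_top](\<lambda>b. 1 / b))"
proof -
  have C: "C = range r" and D: "D = range s"
    using assms(3,4) by (auto simp: bij_betw_def)
  interpret penalized_congruence r s K S \<xi>
    using assms unfolding C D by unfold_locales (auto simp: bij_betw_def)
  show ?thesis
    unfolding C limit_matrix_def[symmetric]
  proof (intro conjI allI impI)
    define \<mu> where "\<mu> = lambda_max (submat r r K)"
    have \<mu>: "\<mu> > 0" unfolding \<mu>_def by (rule lambda_max_K_pos)
    define \<epsilon> where "\<epsilon> b = lambda_max (G b) / (b\<^sup>2 * \<xi>\<^sup>2 * \<mu>) - 1" for b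
    obtain c where c: "\<And>b. 1 \<le> b \<Longrightarrow> \<bar>lambda_max (G b) - b\<^sup>2 * \<xi>\<^sup>2 * \<mu>\<bar> \<le> c * b"
      unfolding \<mu>_def using lambda_max_estimate by blast
    have "\<bar>\<epsilon> b\<bar> \<le> c / (\<xi>\<^sup>2 * \<mu>) * \<bar>1 / b\<bar>" if "1 \<le> b" for b
    proof -
      have "\<epsilon> b = (lambda_max (G b) - b\<^sup>2 * \<xi>\<^sup>2 * \<mu>) / (b\<^sup>2 * \<xi>\<^sup>2 * \<mu>)"
        using that \<mu> xi by (simp add: \<epsilon>_def field_simps)
      then have "\<bar>\<epsilon> b\<bar> = \<bar>lambda_max (G b) - b\<^sup>2 * \<xi>\<^sup>2 * \<mu>\<bar> / (b\<^sup>2 * \<xi>\<^sup>2 * \<mu>)"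
        using \<mu> by (simp add: abs_mult)
      also have "\<dots> \<le> c * b / (b\<^sup>2 * \<xi>\<^sup>2 * \<mu>)"
        using c[OF that] \<mu> by (intro divide_right_mono) auto
      also have "\<dots> = c / (\<xi>\<^sup>2 * \<mu>) * \<bar>1 / b\<bar>"
        using that by (simp add: field_simps power2_eq_square)
      finally show ?thesis .
    qed
    then have "\<epsilon> \<in> O[at_top](\<lambda>b. 1 / b)"
      by (intro bigoI[of _ "c / (\<xi>\<^sup>2 * \<mu>)"] eventually_mono[OF eventually_ge_at_top[of 1]]) simp
    moreover have "lambda_max (G b) = b\<^sup>2 * \<xi>\<^sup>2 * \<mu> * (1 + \<epsilon> b)" if "b > 0" for b
      using that \<mu> xi by (simp add: \<epsilon>_def)
    ultimately show "\<exists>\<epsilon>. \<epsilon> \<in> O[at_top](\<lambda>b. 1 / b) \<and>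
      (\<forall>b>0. lambda_max (G b) = b\<^sup>2 * \<xi>\<^sup>2 * lambda_max (submat r r K) * (1 + \<epsilon> b))"
      unfolding \<mu>_def by blast
  next
    obtain f where f: "(f \<longlongrightarrow> lambda_min limit_matrix) at_top" "eventually (\<lambda>b. lambda_min (G b) \<le> f b) at_top"
      by (rule lambda_min_G_upper)
    obtain g where g: "(g \<longlongrightarrow> lambda_min limit_matrix) at_top"
      "eventually (\<lambda>b. g b \<le> lambda_min (G b)) at_top"
      by (rule lambda_min_G_lower)
    from tendsto_sandwich[OF g(2) f(2) g(1) f(1)]
    show "((\<lambda>b. lambda_min (G b)) \<longlongrightarrow> lambda_min limit_matrix) at_top" .
  next
    show "0 < lambda_min limit_matrix" by (rule pos_def_lambda_min_pos[OF pos_def_limit_matrix])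
  next
    fix v :: "real \<Rightarrow> complex ^ 'n"
    assume v: "\<forall>b>0. norm (v b) = 1 \<and> eigenvector (G b) (complex_of_real (lambda_min (G b))) (v b)"
    obtain c where c: "eventually (\<lambda>b. \<forall>v. norm v = 1 \<longrightarrow> G b *v v = lambda_min (G b) *\<^sub>R v \<longrightarrow>
      norm (subvec r v) \<le> c / b) at_top"
      by (rule min_eigenvector_block_estimate)
    have "eventually (\<lambda>b. norm (norm (subvec r (v b))) \<le> c * norm (1 / b)) at_top"
      using c eventually_gt_at_top[of 0]
    proof eventually_elim
      case (elim b)
      have "norm (v b) = 1" "G b *v v b = lambda_min (G b) *\<^sub>R v b"
        using v elim by (auto simp: eigenvector_def of_real_smult_eq_scaleR)
      then show ?case using elim by simp
    qed
    then show "(\<lambda>b. norm (subvec r (v b))) \<in> O[at_top](\<lambda>b. 1 / b)" by (rule bigoI)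
  qed
qed

end
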